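(* Every finite simple connected graph $G$ on at least two vertices satisfies $$\operatorname{t}(G)\ \ge\ \left\lfloor \frac{\operatorname{g}(G)}{2}\right\rfloor-1+\max_{v\in V(G)}\ell(v),$$ where $\operatorname{g}(G):=0$ if $G$ is acyclic.
   Context: For a finite simple graph $G$: $\operatorname{t}(G)$ is the maximum of $|S|$ over vertex sets $S\subseteq V(G)$ such that the induced subgraph $G[S]$ is a tree (connected and acyclic); $\operatorname{g}(G)$ is the girth, i.e. the minimum length of a cycle of $G$ if $G$ contains a cycle, and $0$ if $G$ is acyclic. For a vertex $v$, $\ell(v)$ is the independence number (maximum size of an independent set) of the subgraph $G[N(v)]$ induced by the open neighbourhood $N(v)$ of $v$. The inequality is between integers (the right-hand side may involve the term $-1$ when $\operatorname{g}(G)=0$; no truncated subtraction is meant). *)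

theory Defs
  imports Complex_Main "Graph_Theory.Digraph_Component"
begin

text \<open>
  A finite simple graph is a pre-digraph \<open>G\<close> satisfying the library locale predicate
  \<open>graph G\<close>: finite, loop-free, without parallel arcs, and symmetric, so that each undirected
  edge \<open>uv\<close> is represented by the two arcs \<open>u \<rightarrow> v\<close> and \<open>v \<rightarrow> u\<close>.  The library predicates
  \<open>connected\<close> (which excludes the null graph) and \<open>induce_subgraph\<close> (written \<open>G \<restriction> S\<close>)
  are used as they stand.

  The library's \<open>forest\<close> and \<open>tree\<close> are not usable for this encoding: they rely on the directed
  notion \<open>pre_digraph.cycle\<close>, for which the closed walk \<open>u, v, u\<close> along the two arcs of one
  undirected edge is a cycle.  In a simple graph the cycles in the undirected sense are exactly
  the directed ones of length at least 3.
\<close>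

definition undirected_cycle :: "('a, 'b) pre_digraph \<Rightarrow> 'b list \<Rightarrow> bool" where
  "undirected_cycle G p \<longleftrightarrow> pre_digraph.cycle G p \<and> 3 \<le> length p"

definition undirected_acyclic :: "('a, 'b) pre_digraph \<Rightarrow> bool" where
  "undirected_acyclic G \<longleftrightarrow> \<not> (\<exists>p. undirected_cycle G p)"

definition undirected_tree :: "('a, 'b) pre_digraph \<Rightarrow> bool" where
  "undirected_tree G \<longleftrightarrow> Digraph_Component.connected G \<and> undirected_acyclic G"

definition tree_number :: "('a, 'b) pre_digraph \<Rightarrow> nat" where
  "tree_number G = Max {card S | S. S \<subseteq> verts G \<and> undirected_tree (G \<restriction> S)}"

definition girth :: "('a, 'b) pre_digraph \<Rightarrow> nat" where
  "girth G = (if undirected_acyclic G then 0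
              else (LEAST n. \<exists>p. undirected_cycle G p \<and> length p = n))"

definition neighbourhood :: "('a, 'b) pre_digraph \<Rightarrow> 'a \<Rightarrow> 'a set" where
  "neighbourhood G v = {u \<in> verts G. v \<rightarrow>\<^bsub>G\<^esub> u}"

definition independent_set :: "('a, 'b) pre_digraph \<Rightarrow> 'a set \<Rightarrow> bool" where
  "independent_set G A \<longleftrightarrow> A \<subseteq> verts G \<and> (\<forall>u\<in>A. \<forall>v\<in>A. \<not> u \<rightarrow>\<^bsub>G\<^esub> v)"

definition independence_number :: "('a, 'b) pre_digraph \<Rightarrow> nat" where
  "independence_number G = Max {card A | A. independent_set G A}"

definition local_independence :: "('a, 'b) pre_digraph \<Rightarrow> 'a \<Rightarrow> nat" where
  "local_independence G v = independence_number (G \<restriction> neighbourhood G v)"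

end

theory Submission
  imports Defs
begin

text \<open>
  Let \<open>d\<close> be the distance from \<open>v\<close>.  On a cycle, a vertex \<open>u\<close> maximising \<open>d\<close> has two
  neighbours that are not farther from \<open>v\<close> than \<open>u\<close>.  If both lie on the level of \<open>u\<close>, one of
  them can be replaced by a neighbour on the level below; so geodesics from the two neighbours to
  \<open>v\<close> close up to a cycle of length at most \<open>2 d(u) + 1\<close>.  Hence with \<open>k = \<lfloor>g/2\<rfloor> - 1\<close> every
  union of geodesics from \<open>v\<close> of length at most \<open>k\<close> induces a tree, while a
  graph of girth \<open>g > 0\<close> cannot lie within radius \<open>k - 1\<close>.  The closed neighbourhood of \<open>v\<close>
  together with a geodesic of length \<open>k\<close> is a tree on \<open>deg(v) + k\<close> vertices.  For \<open>g < 4\<close>, the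
  star formed by \<open>v\<close> and a largest independent set of neighbours suffices.
\<close>

section \<open>Cycles and vertex sequences\<close>

lemma (in wf_digraph) successively_imp_awalk:
  assumes "successively (\<lambda>a b. a \<rightarrow> b) (x # xs)" "x \<in> verts G"
  shows "\<exists>p. awalk x p (last (x # xs)) \<and> awalk_verts x p = x # xs"
  using assms
proof (induction xs arbitrary: x)
  case Nil
  then show ?case by (intro exI[of _ "[]"]) (auto simp: awalk_Nil_iff)
next
  case (Cons y ys)
  then obtain e where e: "e \<in> arcs G" "tail G e = x" "head G e = y" by auto
  then have "y \<in> verts G" by auto
  with Cons obtain p where "awalk y p (last (y # ys))" "awalk_verts y p = y # ys" by auto
  with e Cons.prems show ?case
    by (intro exI[of _ "e # p"]) (auto simp: awalk_Cons_iff)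
qed

text \<open>Passes from vertex lists to the arc lists used by \<open>cycle\<close>. Prefixing the
  last vertex closes the walk, and \<open>cycle\<close> asks for distinctness only on the tail of
  its vertex sequence, which is then \<open>xs\<close>.\<close>

lemma (in wf_digraph) vertex_list_imp_undirected_cycle:
  assumes "successively (\<lambda>a b. a \<rightarrow> b) (last xs # xs)" "distinct xs" "3 \<le> length xs"
  shows "\<exists>c. undirected_cycle G c \<and> length c = length xs"
proof -
  have "last xs \<in> verts G"
    using assms(1,3) by (cases xs) (auto simp del: last.simps dest: adj_in_verts)
  then obtain p where p: "awalk (last xs) p (last (last xs # xs))"
      "awalk_verts (last xs) p = last xs # xs"
    using successively_imp_awalk[OF assms(1)] by blast
  then have "length p = length xs"
    using length_awalk_verts[of "last xs" p] by simp
  moreover have "last (last xs # xs) = last xs"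
    using assms(3) by auto
  ultimately show ?thesis
    using p assms unfolding undirected_cycle_def cycle_def
    by (intro exI[of _ p]) auto
qed

lemma (in wf_digraph) awalk_verts_nth_dominates:
  assumes "awalk u p v" "i < length p"
  shows "awalk_verts u p ! i \<rightarrow> awalk_verts u p ! Suc i"
  using assms
proof (induction p arbitrary: u i)
  case (Cons e p)
  then show ?case
    by (cases i; cases p) (auto simp: awalk_Cons_iff dest: in_arcs_imp_in_arcs_ends)
qed simp

text \<open>A cycle vertex of largest \<open>h\<close> serves as \<open>x\<close>, its two cycle
  neighbours as \<open>y\<close> and \<open>z\<close>; these differ because the length is at least
  3. Both the acyclicity of the trees and the existence of far vertices rest on this.\<close>

lemma (in sym_digraph) undirected_cycle_local_max:
  fixes h :: "'a \<Rightarrow> nat"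
  assumes "undirected_cycle G c"
  obtains x y z where "x \<rightarrow> y" "x \<rightarrow> z" "y \<noteq> z" "h y \<le> h x" "h z \<le> h x"
proof -
  obtain u where u: "awalk u c u" "distinct (tl (awalk_verts u c))" and len: "3 \<le> length c"
    using assms by (auto simp: undirected_cycle_def cycle_def)
  define w where "w i = awalk_verts u c ! i" for i
  define n where "n = length c"
  have wstep: "w i \<rightarrow> w (Suc i)" if "i < n" for i
    using awalk_verts_nth_dominates[OF u(1)] that by (auto simp: w_def n_def)
  have wends: "w 0 = w n"
  proof -
    have "w 0 = u"
      using awhd_of_awalk[OF u(1)] by (simp add: w_def hd_conv_nth)
    moreover have "w n = u"
      using u(1) by (auto simp: w_def n_def last_conv_nth length_awalk_verts elim!: awalkE)
    ultimately show ?thesis by simp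
  qed
  \<comment> \<open>Indices run from 1 to \<open>n\<close>, since distinctness is known only for the
    tail of the vertex sequence; \<open>w 0\<close> repeats \<open>w n\<close>.\<close>
  have inj: "i = j" if "w i = w j" "1 \<le> i" "i \<le> n" "1 \<le> j" "j \<le> n" for i j
  proof -
    have "tl (awalk_verts u c) ! (i - 1) = tl (awalk_verts u c) ! (j - 1)"
      using that by (simp add: w_def n_def nth_tl length_awalk_verts)
    with u(2) that have "i - 1 = j - 1"
      by (subst (asm) nth_eq_iff_index_eq) (auto simp: n_def length_awalk_verts)
    with that show ?thesis by simp
  qed
  have I: "finite ((\<lambda>i. h (w i)) ` {1..n})" "(\<lambda>i. h (w i)) ` {1..n} \<noteq> {}"
    using len by (auto simp: n_def)
  obtain i where i: "i \<in> {1..n}" and "Max ((\<lambda>i. h (w i)) ` {1..n}) = h (w i)"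
    using Max_in[OF I] by (elim imageE)
  with Max_ge[OF I(1)] have imax: "h (w j) \<le> h (w i)" if "1 \<le> j" "j \<le> n" for j
    using that by (metis atLeastAtMost_iff imageI)
  have n3: "3 \<le> n" using len n_def by simp
  \<comment> \<open>Cyclic predecessor and successor of \<open>i\<close> in \<open>{1..n}\<close>;
    they differ since \<open>n\<close> is at least 3.\<close>
  define a where "a = (if i = 1 then n else i - 1)"
  define b where "b = (if i = n then 1 else Suc i)"
  have ab: "1 \<le> a" "a \<le> n" "1 \<le> b" "b \<le> n" "a \<noteq> b"
    using i n3 by (auto simp: a_def b_def)
  have "w a \<rightarrow> w i"
    using wstep[of "i - 1"] i wends by (auto simp: a_def)
  moreover have "w i \<rightarrow> w b"
    using wstep[of i] wstep[of 0] i n3 wends by (auto simp: b_def)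
  ultimately show thesis
    using ab imax inj that graph_symmetric by metis
qed

text \<open>Descending in \<open>h\<close> ends at \<open>r\<close>, so all vertices are joined
  through \<open>r\<close>. A cycle would have a vertex of maximal height with two distinct
  neighbours not above it, against \<open>uniq\<close>.\<close>

lemma (in graph) undirected_treeI_height:
  fixes h :: "'a \<Rightarrow> nat"
  assumes "S \<subseteq> verts G" "r \<in> S"
    and down: "\<And>x. x \<in> S \<Longrightarrow> x \<noteq> r \<Longrightarrow> \<exists>y\<in>S. x \<rightarrow> y \<and> h y < h x"
    and uniq: "\<And>x y z. \<lbrakk>x \<in> S; y \<in> S; z \<in> S; x \<rightarrow> y; x \<rightarrow> z; h y \<le> h x; h z \<le> h x\<rbrakk> \<Longrightarrow> y = z"
  shows "undirected_tree (G \<restriction> S)"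
proof -
  have ind: "induced_subgraph (G \<restriction> S) G"
    using assms(1) by (rule induced_induce)
  interpret H: sym_digraph "G \<restriction> S"
    by (rule induced_graph_imp_graph[OF ind])
  have dom: "x \<rightarrow>\<^bsub>G \<restriction> S\<^esub> y \<longleftrightarrow> x \<in> S \<and> y \<in> S \<and> x \<rightarrow> y" for x y
    by (auto simp: arcs_ends_conv)
  have to_root: "x \<rightarrow>\<^sup>*\<^bsub>G \<restriction> S\<^esub> r" if "x \<in> S" for x
    using that
  proof (induction "h x" arbitrary: x rule: less_induct)
    case less
    show ?case
    proof (cases "x = r")
      case True
      with assms(2) show ?thesis by auto
    next
      case False
      with less down obtain y where "y \<in> S" "x \<rightarrow> y" "h y < h x" by blast
      with less show ?thesis
        by (meson H.adj_reachable_trans dom)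
    qed
  qed
  have "strongly_connected (G \<restriction> S)"
  proof (rule strongly_connectedI)
    show "verts (G \<restriction> S) \<noteq> {}" using assms(2) by auto
    fix x y assume "x \<in> verts (G \<restriction> S)" "y \<in> verts (G \<restriction> S)"
    then have "x \<rightarrow>\<^sup>*\<^bsub>G \<restriction> S\<^esub> r" "r \<rightarrow>\<^sup>*\<^bsub>G \<restriction> S\<^esub> y"
      using to_root symmetric_reachable[OF H.sym_arcs] by simp_all
    then show "x \<rightarrow>\<^sup>*\<^bsub>G \<restriction> S\<^esub> y" by (rule H.reachable_trans)
  qed
  then have "Digraph_Component.connected (G \<restriction> S)"
    unfolding connected_def strongly_connected_def
    by (auto simp: H.reachable_mk_symmetric_eq[OF H.sym_arcs])
  moreover have "undirected_acyclic (G \<restriction> S)"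
    unfolding undirected_acyclic_def
  proof (intro notI, elim exE)
    fix c assume "undirected_cycle (G \<restriction> S) c"
    from H.undirected_cycle_local_max[OF this, of h]
    show False using uniq unfolding dom by metis
  qed
  ultimately show ?thesis
    by (simp add: undirected_tree_def)
qed

section \<open>Extremal parameters and stars\<close>

lemma girth_le:
  assumes "undirected_cycle G c"
  shows "girth G \<le> length c"
  using assms unfolding girth_def undirected_acyclic_def by (auto intro: Least_le)

lemma (in fin_digraph) card_le_tree_number:
  assumes "S \<subseteq> verts G" "undirected_tree (G \<restriction> S)"
  shows "card S \<le> tree_number G"
proof -
  have "{card S | S. S \<subseteq> verts G \<and> undirected_tree (G \<restriction> S)} \<subseteq> card ` Pow (verts G)" by auto
  then have "finite {card S | S. S \<subseteq> verts G \<and> undirected_tree (G \<restriction> S)}"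
    by (rule finite_subset) simp
  then show ?thesis
    unfolding tree_number_def using assms by (intro Max_ge) auto
qed

lemma (in fin_digraph) obtain_local_independent_set:
  obtains A where "A \<subseteq> neighbourhood G v" "\<And>x y. x \<in> A \<Longrightarrow> y \<in> A \<Longrightarrow> \<not> x \<rightarrow> y"
    "card A = local_independence G v"
proof -
  let ?N = "neighbourhood G v"
  let ?C = "{card A | A. independent_set (G \<restriction> ?N) A}"
  have "finite ?N" by (simp add: neighbourhood_def)
  have "?C \<subseteq> card ` Pow ?N" by (auto simp: independent_set_def)
  then have "finite ?C"
    by (rule finite_subset) (use \<open>finite ?N\<close> in simp)
  \<comment> \<open>The empty set keeps the family nonempty, so that \<open>Max\<close> is
    attained.\<close>
  moreover have "card {} \<in> ?C"
    by (intro CollectI exI[of _ "{}"]) (simp add: independent_set_def)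
  ultimately have "local_independence G v \<in> ?C"
    unfolding local_independence_def independence_number_def by (intro Max_in) auto
  then obtain A where A: "independent_set (G \<restriction> ?N) A" "card A = local_independence G v" by auto
  show thesis
  proof
    show sub: "A \<subseteq> ?N" using A by (auto simp: independent_set_def)
    show "\<not> x \<rightarrow> y" if "x \<in> A" "y \<in> A" for x y
      using A that sub by (auto simp: independent_set_def arcs_ends_conv)
  qed (fact A(2))
qed

text \<open>The centre gets height 0 and the leaves height 1; by independence a leaf has no
  neighbour in the set other than \<open>v\<close>.\<close>

lemma (in graph) star_tree:
  assumes "v \<in> verts G" "A \<subseteq> neighbourhood G v" "\<And>x y. x \<in> A \<Longrightarrow> y \<in> A \<Longrightarrow> \<not> x \<rightarrow> y"
  shows "undirected_tree (G \<restriction> insert v A)"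
proof (rule undirected_treeI_height[where r = v and h = "\<lambda>x. if x = v then 0 else 1"])
  show "insert v A \<subseteq> verts G" using assms by (auto simp: neighbourhood_def)
  fix x y z
  assume "x \<in> insert v A" "y \<in> insert v A" "z \<in> insert v A" "x \<rightarrow> y" "x \<rightarrow> z"
    "(if y = v then 0 else 1) \<le> (if x = v then 0 else (1::nat))"
    "(if z = v then 0 else 1) \<le> (if x = v then 0 else (1::nat))"
  with assms(3) show "y = z"
    using adj_not_same by (auto split: if_splits)
qed (use assms graph_symmetric adj_not_same in \<open>auto simp: neighbourhood_def\<close>)

section \<open>Distance levels\<close>

text \<open>The axioms pin \<open>d\<close> down as the distance from \<open>r\<close>: by
  \<open>level_step\<close> it is at most the length of any walk from \<open>r\<close>, and
  following \<open>parent\<close> yields a walk of length \<open>d x\<close>.\<close>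

locale levelled_graph = graph G for G :: "('a, 'b) pre_digraph" (structure) +
  fixes r :: 'a and d :: "'a \<Rightarrow> nat"
  assumes root: "r \<in> verts G" "d r = 0"
    and parent: "\<And>x. x \<in> verts G \<Longrightarrow> x \<noteq> r \<Longrightarrow> \<exists>y. x \<rightarrow> y \<and> d x = Suc (d y)"
    and level_step: "\<And>x y. x \<rightarrow> y \<Longrightarrow> d y \<le> Suc (d x)"

lemma (in graph) connected_graph_levelled:
  assumes "Digraph_Component.connected G" "r \<in> verts G"
  shows "\<exists>d. levelled_graph G r d"
proof -
  define d where "d x = (LEAST n. (r, x) \<in> arcs_ends G ^^ n)" for x
  have least: "d x \<le> n" if "(r, x) \<in> arcs_ends G ^^ n" for x n
    unfolding d_def using that by (rule Least_le)
  have walk: "(r, x) \<in> arcs_ends G ^^ d x" if "x \<in> verts G" for x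
  proof -
    have "r \<rightarrow>\<^sup>* x"
      using assms that unfolding connected_def strongly_connected_def
      by (simp add: reachable_mk_symmetric_eq[OF sym_arcs])
    then have "(r, x) \<in> (arcs_ends G)\<^sup>*" by (rule reachable_rtranclI)
    then have "\<exists>n. (r, x) \<in> arcs_ends G ^^ n" by (simp add: rtrancl_power)
    then show ?thesis unfolding d_def by (rule LeastI_ex)
  qed
  have step: "d y \<le> Suc (d x)" if "x \<rightarrow> y" for x y
    using walk[of x] that adj_in_verts(1) by (intro least) auto
  have "levelled_graph G r d"
  proof unfold_locales
    show "r \<in> verts G" by fact
    show "d r = 0" using least[of r 0] by simp
    show "d y \<le> Suc (d x)" if "x \<rightarrow> y" for x y by (rule step) fact
    fix x assume x: "x \<in> verts G" "x \<noteq> r"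
    then obtain n where n: "d x = Suc n"
      using walk[of x] by (cases "d x") auto
    with walk[of x] x obtain y where y: "(r, y) \<in> arcs_ends G ^^ n" "y \<rightarrow> x" by auto
    \<comment> \<open>\<open>y\<close> precedes \<open>x\<close> on a shortest walk:
      \<open>least\<close> gives \<open>d y \<le> n\<close>, and \<open>step\<close> the
      converse.\<close>
    with least[OF y(1)] step[OF y(2)] n have "d x = Suc (d y)" by simp
    with y(2) graph_symmetric show "\<exists>y. x \<rightarrow> y \<and> d x = Suc (d y)" by blast
  qed
  then show ?thesis by blast
qed

section \<open>Geodesics and short cycles\<close>

context levelled_graph begin

text \<open>Indexing by level makes \<open>d\<close> a left inverse of \<open>p\<close>, so a
  geodesic is injective and two geodesics can meet only at equal indices.\<close>

lemma obtain_geodesic: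
  assumes "x \<in> verts G"
  obtains p where "p 0 = r" "p (d x) = x" "\<And>i. i \<le> d x \<Longrightarrow> p i \<in> verts G"
    "\<And>i. i \<le> d x \<Longrightarrow> d (p i) = i" "\<And>i. i < d x \<Longrightarrow> p (Suc i) \<rightarrow> p i"
proof -
  have "\<exists>p. p 0 = r \<and> p (d x) = x \<and> (\<forall>i\<le>d x. p i \<in> verts G \<and> d (p i) = i)
    \<and> (\<forall>i<d x. p (Suc i) \<rightarrow> p i)"
    using assms
  proof (induction "d x" arbitrary: x)
    case 0
    then have "x = r" using parent by fastforce
    with root show ?case by (intro exI[of _ "\<lambda>_. r"]) auto
  next
    case (Suc n)
    then have "x \<noteq> r" using root by auto
    with Suc.prems parent obtain y where y: "x \<rightarrow> y" "d x = Suc (d y)" by blast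
    with Suc obtain p where p: "p 0 = r" "p n = y" "\<forall>i\<le>n. p i \<in> verts G \<and> d (p i) = i"
        "\<forall>i<n. p (Suc i) \<rightarrow> p i"
      using adj_in_verts(2) by (metis Suc_inject)
    with y Suc.prems Suc.hyps(2)[symmetric] show ?case
      by (intro exI[of _ "p(Suc n := x)"]) (auto simp: le_Suc_eq less_Suc_eq)
  qed
  then show thesis using that by blast
qed

text \<open>Let \<open>m\<close> be the highest level at which the two geodesics agree. Going from
  \<open>a\<close> down to the meeting vertex, up to \<open>b\<close> and back through
  \<open>u\<close> gives a cycle of length \<open>(d a - m) + (d b - m) + 2\<close>.\<close>

lemma geodesics_close_up_to_cycle:
  assumes u: "u \<rightarrow> a" "u \<rightarrow> b" "a \<noteq> b" "d a \<le> d u" "d b \<le> d u"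
  shows "\<exists>c. undirected_cycle G c \<and> length c \<le> d a + d b + 2"
proof -
  obtain p where p: "p 0 = r" "p (d a) = a" "\<And>i. i \<le> d a \<Longrightarrow> d (p i) = i"
      "\<And>i. i < d a \<Longrightarrow> p (Suc i) \<rightarrow> p i"
    using obtain_geodesic[of a] adj_in_verts(2)[OF u(1)] by metis
  obtain q where q: "q 0 = r" "q (d b) = b" "\<And>i. i \<le> d b \<Longrightarrow> d (q i) = i"
      "\<And>i. i < d b \<Longrightarrow> q (Suc i) \<rightarrow> q i"
    using obtain_geodesic[of b] adj_in_verts(2)[OF u(2)] by metis
  define M where "M = {m. m \<le> d a \<and> m \<le> d b \<and> p m = q m}"
  have M: "finite M" "M \<noteq> {}"
    using p(1) q(1) by (auto simp: M_def)
  define m where "m = Max M"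
  have "m \<in> M" unfolding m_def using M by (rule Max_in)
  then have m: "m \<le> d a" "m \<le> d b" "p m = q m" by (auto simp: M_def)
  have mmax: "i \<le> m" if "i \<le> d a" "i \<le> d b" "p i = q i" for i
    unfolding m_def using M that by (intro Max_ge) (auto simp: M_def)
  \<comment> \<open>Otherwise \<open>a = b\<close>. This supplies the third vertex of the
    cycle.\<close>
  have nm: "m < d a \<or> m < d b"
    using m p(2) q(2) u(3) by (metis le_neq_implies_less)
  \<comment> \<open>\<open>P\<close> descends from \<open>a\<close> to the meeting vertex;
    \<open>Q\<close> starts one level above it, so that vertex occurs once.\<close>
  define P where "P = map p (rev [m..<Suc (d a)])"
  define Q where "Q = map q [Suc m..<Suc (d b)]"
  define xs where "xs = P @ Q @ [u]"
  have last: "last xs = u" by (simp add: xs_def)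
  have pinj: "inj_on p {..d a}" by (rule inj_on_inverseI[of _ d]) (simp add: p(3))
  have qinj: "inj_on q {..d b}" by (rule inj_on_inverseI[of _ d]) (simp add: q(3))
  \<comment> \<open>If \<open>u = p i\<close>, then \<open>i = d u\<close>, so
    \<open>i = d a\<close> and \<open>u = a\<close>, which would be a loop.\<close>
  have up: False if "u = p i" "i \<le> d a" for i
    using that p(2,3) u(1,4) adj_not_same by (metis le_antisym)
  have uq: False if "u = q i" "i \<le> d b" for i
    using that q(2,3) u(2,5) adj_not_same by (metis le_antisym)
  \<comment> \<open>Equality would force \<open>i = j\<close>, a common vertex above level
    \<open>m\<close>.\<close>
  have pq: "p i \<noteq> q j" if "i \<le> d a" "Suc m \<le> j" "j \<le> d b" for i j
    using that p(3) q(3) mmax by (metis Suc_n_not_le_n le_trans)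
  have sets: "set P \<subseteq> p ` {..d a}" "set Q \<subseteq> q ` {Suc m..d b}"
    by (auto simp: P_def Q_def simp del: upt_Suc)
  have "u \<notin> set P"
    by (rule contra_subsetD[OF sets(1)]) (rule notI, erule imageE, erule up, simp)
  moreover have "u \<notin> set Q"
    by (rule contra_subsetD[OF sets(2)]) (rule notI, erule imageE, erule uq, simp)
  moreover have "p ` {..d a} \<inter> q ` {Suc m..d b} = {}"
    using pq by (auto simp: disjoint_iff)
  then have "set P \<inter> set Q = {}"
    using sets by blast
  moreover have "distinct P" "distinct Q"
    by (auto simp: P_def Q_def distinct_map simp del: upt_Suc
      intro: inj_on_subset[OF pinj] inj_on_subset[OF qinj])
  ultimately have "distinct xs"
    by (simp add: xs_def)
  moreover have "successively (\<lambda>a b. a \<rightarrow> b) (last xs # xs)"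
  proof -
    have "successively (\<lambda>a b. b \<rightarrow> a) (map p [m..<Suc (d a)])"
      using p(4) by (auto simp: successively_map successively_conv_nth simp del: upt_Suc)
    then have "successively (\<lambda>a b. a \<rightarrow> b) P"
      unfolding P_def rev_map[symmetric] successively_rev .
    moreover have "P \<noteq> []" "hd P = a" "last P = p m"
      using m p(2) by (auto simp: P_def hd_map last_map hd_rev last_rev simp del: upt_Suc)
    ultimately have P: "successively (\<lambda>a b. a \<rightarrow> b) P" "P \<noteq> []" "hd P = a" "last P = p m"
      by simp_all
    have Q: "successively (\<lambda>a b. a \<rightarrow> b) Q"
      using q(4) graph_symmetric
      by (auto simp: Q_def successively_map successively_conv_nth simp del: upt_Suc)
    have "b \<rightarrow> u" using u(2) graph_symmetric by blast
    show ?thesis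
    proof (cases "m < d b")
      case True
      then have "Q \<noteq> []" "hd Q = q (Suc m)" "last Q = b"
        using q(2) by (auto simp: Q_def hd_map last_map simp del: upt_Suc)
      moreover have "p m \<rightarrow> q (Suc m)"
        using True m(3) q(4) graph_symmetric by auto
      ultimately show ?thesis
        unfolding last using P Q u(1) \<open>b \<rightarrow> u\<close>
        by (simp add: xs_def successively_append_iff successively_Cons)
    next
      \<comment> \<open>Here the meeting vertex is \<open>b\<close> itself, so \<open>P\<close>
        alone already leads from \<open>a\<close> to \<open>b\<close>.\<close>
      case False
      then have "Q = []" "p m = b"
        using m q(2) by (auto simp: Q_def)
      then show ?thesis
        unfolding last using P u(1) \<open>b \<rightarrow> u\<close>
        by (simp add: xs_def successively_append_iff successively_Cons)
    qed
  qed
  moreover have len: "length xs = (d a - m) + (d b - m) + 2"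
  proof -
    have "length P = Suc (d a - m)" "length Q = d b - m"
      using m by (simp_all add: P_def Q_def Suc_diff_le del: upt_Suc)
    then show ?thesis by (simp add: xs_def)
  qed
  moreover have "3 \<le> length xs"
    using len nm by linarith
  ultimately obtain c where "undirected_cycle G c" "length c = length xs"
    using vertex_list_imp_undirected_cycle by blast
  moreover have "length xs \<le> d a + d b + 2"
    using len by linarith
  ultimately show ?thesis by auto
qed

lemma short_cycle:
  assumes u: "u \<rightarrow> a" "u \<rightarrow> b" "a \<noteq> b" "d a \<le> d u" "d b \<le> d u"
  shows "\<exists>c. undirected_cycle G c \<and> length c \<le> 2 * d u + 1"
proof (cases "d a < d u \<or> d b < d u")
  case True
  with geodesics_close_up_to_cycle[OF u] u(4,5) show ?thesis by fastforce
next
  case False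
  \<comment> \<open>Only \<open>r\<close> has level 0, so the root has no neighbour on its own
    level.\<close>
  have "u \<noteq> r"
  proof
    assume "u = r"
    with u(4) root have "d a = 0" by simp
    with parent[of a] adj_in_verts(2)[OF u(1)] have "a = r" by auto
    with u(1) \<open>u = r\<close> adj_not_same show False by blast
  qed
  with parent[of u] adj_in_verts(1)[OF u(1)] obtain c where c: "u \<rightarrow> c" "d u = Suc (d c)" by blast
  with False have "a \<noteq> c" by auto
  with geodesics_close_up_to_cycle[OF u(1) c(1)] u(4) c(2) show ?thesis by fastforce
qed

lemma unique_parent:
  assumes "2 * d u + 1 < girth G" "u \<rightarrow> a" "u \<rightarrow> b" "d a \<le> d u" "d b \<le> d u"
  shows "a = b"
  using short_cycle[of u a b] girth_le assms by fastforce

lemma ex_far_vertex: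
  assumes "girth G \<noteq> 0" "2 * k < girth G"
  shows "\<exists>x\<in>verts G. k \<le> d x"
proof (rule ccontr)
  assume near: "\<not> ?thesis"
  \<comment> \<open>The value 0 being reserved for acyclic graphs, nonzero girth yields a
    cycle.\<close>
  obtain c where "undirected_cycle G c"
    using assms(1) by (auto simp: girth_def undirected_acyclic_def split: if_splits)
  from undirected_cycle_local_max[OF this, of d]
  obtain x y z where x: "x \<rightarrow> y" "x \<rightarrow> z" "y \<noteq> z" "d y \<le> d x" "d z \<le> d x" by blast
  then have "d x < k" using near adj_in_verts(1) by (metis not_le)
  with assms(2) have "2 * d x + 1 < girth G" by linarith
  with x show False using unique_parent by blast
qed

section \<open>Trees within a small radius\<close>

lemma ball_tree:
  assumes "S \<subseteq> verts G" "r \<in> S" "\<And>x. x \<in> S \<Longrightarrow> x \<noteq> r \<Longrightarrow> \<exists>y\<in>S. x \<rightarrow> y \<and> d y < d x"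
    and "\<And>x. x \<in> S \<Longrightarrow> 2 * d x + 1 < girth G"
  shows "undirected_tree (G \<restriction> S)"
proof (rule undirected_treeI_height[where h = d])
  show "y = z" if "x \<in> S" "x \<rightarrow> y" "x \<rightarrow> z" "d y \<le> d x" "d z \<le> d x" for x y z
    using unique_parent[OF assms(4)] that .
qed (fact assms)+

text \<open>The geodesic meets the closed neighbourhood of \<open>r\<close> at levels 0 and 1, so
  levels 2 to \<open>k\<close> add \<open>k - 1\<close> vertices to its
  \<open>1 + card (neighbourhood G r)\<close>. The vertex \<open>x\<close> may lie beyond level
  \<open>k\<close>; only the initial part of its geodesic is used.\<close>

lemma tree_number_ge_degree:
  assumes "0 < k" "2 * k + 1 < girth G"
  shows "k + card (neighbourhood G r) \<le> tree_number G"
proof -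
  let ?N = "neighbourhood G r"
  obtain x where x: "x \<in> verts G" "k \<le> d x"
    using ex_far_vertex[of k] assms by auto
  obtain p where p: "p 0 = r" "\<And>i. i \<le> d x \<Longrightarrow> p i \<in> verts G"
      "\<And>i. i \<le> d x \<Longrightarrow> d (p i) = i" "\<And>i. i < d x \<Longrightarrow> p (Suc i) \<rightarrow> p i"
    using obtain_geodesic[OF x(1)] by metis
  have N: "d y = 1 \<and> y \<rightarrow> r \<and> y \<in> verts G" if "y \<in> ?N" for y
  proof -
    have y: "r \<rightarrow> y" "y \<in> verts G" using that by (auto simp: neighbourhood_def)
    then have "y \<noteq> r" using adj_not_same by blast
    with parent[OF y(2)] level_step[OF y(1)] root y graph_symmetric show ?thesis by auto
  qed
  let ?P = "p ` {2..k}"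
  let ?S = "insert r ?N \<union> ?P"
  have "finite ?N" by (simp add: neighbourhood_def)
  have P: "\<exists>i. y = p i \<and> 2 \<le> i \<and> i \<le> k \<and> d y = i \<and> y \<in> verts G" if "y \<in> ?P" for y
    using that x p by auto
  have "inj_on p {2..k}"
  proof (rule inj_on_inverseI)
    show "d (p i) = i" if "i \<in> {2..k}" for i using that p(3) x(2) by simp
  qed
  then have "card ?P = k - 1" by (simp add: card_image)
  moreover have "r \<notin> ?N" using adj_not_same by (auto simp: neighbourhood_def)
  moreover have "insert r ?N \<inter> ?P = {}"
    using N P root by fastforce
  ultimately have "card ?S = k + card ?N"
    using \<open>finite ?N\<close> assms(1) by (subst card_Un_disjoint) auto
  moreover have "?S \<subseteq> verts G" using N P root by blast
  moreover have "undirected_tree (G \<restriction> ?S)"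
  proof (rule ball_tree)
    show "?S \<subseteq> verts G" by fact
    show "r \<in> ?S" by simp
    show "2 * d y + 1 < girth G" if "y \<in> ?S" for y
    proof -
      have "d y \<le> k" using that N P root assms(1) by fastforce
      with assms(2) show ?thesis by simp
    qed
    show "\<exists>z\<in>?S. y \<rightarrow> z \<and> d z < d y" if y: "y \<in> ?S" "y \<noteq> r" for y
    proof (cases "y \<in> ?N")
      case True
      with N root show ?thesis by (intro bexI[of _ r]) auto
    next
      case False
      with y P obtain i where i: "y = p i" "2 \<le> i" "i \<le> k" by blast
      then obtain j where j: "i = Suc j" "1 \<le> j" by (cases i) auto
      with i p(4) x have dom: "y \<rightarrow> p j" by simp
      have "p j \<in> ?S"
      \<comment> \<open>\<open>p 1\<close> is outside \<open>?P\<close>, but it belongs to the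
        neighbourhood of \<open>r\<close>; here the path is attached to the star.\<close>
      proof (cases "j = 1")
        case True
        then have "r \<rightarrow> p j"
          using p(1) p(4)[of 0] x assms(1) graph_symmetric by auto
        then show ?thesis using adj_in_verts(2) by (auto simp: neighbourhood_def)
      next
        case False
        with i j show ?thesis by auto
      qed
      moreover have "d (p j) < d y" using i j x p(3) by simp
      ultimately show ?thesis using dom by blast
    qed
  qed
  ultimately show ?thesis
    using card_le_tree_number by metis
qed

end

section \<open>Small and large girth combined\<close>

theorem corollary2p2:
  fixes G :: "('a, 'b) pre_digraph"
  assumes "graph G"
    and "Digraph_Component.connected G"
    and "card (verts G) \<ge> 2"
  shows "int (tree_number G)
           \<ge> \<lfloor>real (girth G) / 2\<rfloor> - 1 + int (MAX v\<in>verts G. local_independence G v)"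
proof -
  interpret graph G by fact
  have "verts G \<noteq> {}" using assms(3) by auto
  then have "(MAX v\<in>verts G. local_independence G v) \<in> local_independence G ` verts G"
    by (intro Max_in) auto
  then obtain v where v: "v \<in> verts G"
      and Max: "(MAX v\<in>verts G. local_independence G v) = local_independence G v"
    by auto
  obtain A where A: "A \<subseteq> neighbourhood G v" "\<And>x y. x \<in> A \<Longrightarrow> y \<in> A \<Longrightarrow> \<not> x \<rightarrow>\<^bsub>G\<^esub> y"
      "card A = local_independence G v"
    using obtain_local_independent_set[of v] by metis
  have fin: "finite (neighbourhood G v)" by (simp add: neighbourhood_def)
  have floor: "\<lfloor>real (girth G) / 2\<rfloor> = int (girth G div 2)"
    using floor_divide_of_nat_eq[of "girth G" 2] by simp
  \<comment> \<open>Moving the \<open>- 1\<close> across keeps the inequality in the naturals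
    without truncation.\<close>
  have "girth G div 2 + local_independence G v \<le> Suc (tree_number G)"
  \<comment> \<open>Below 4, including the acyclic value 0, \<open>girth G div 2\<close> is at most
    1 and the star suffices. From 4 on, \<open>k = girth G div 2 - 1\<close> is positive and
    \<open>2 * k + 1 < girth G\<close>.\<close>
  proof (cases "girth G < 4")
    case True
    have "v \<notin> A" using A(1) adj_not_same by (auto simp: neighbourhood_def)
    then have "card (insert v A) = Suc (local_independence G v)"
      using A finite_subset[OF A(1) fin] by simp
    moreover have "insert v A \<subseteq> verts G" using v A(1) by (auto simp: neighbourhood_def)
    ultimately have "Suc (local_independence G v) \<le> tree_number G"
      using card_le_tree_number star_tree[OF v A(1,2)] by metis
    with True show ?thesis by linarith
  next
    case False
    obtain d where "levelled_graph G v d"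
      using connected_graph_levelled[OF assms(2) v] by blast
    then interpret levelled_graph G v d .
    have "girth G div 2 - 1 + card (neighbourhood G v) \<le> tree_number G"
      using False by (intro tree_number_ge_degree) linarith+
    moreover have "local_independence G v \<le> card (neighbourhood G v)"
      using card_mono[OF fin A(1)] A(3) by simp
    ultimately show ?thesis by linarith
  qed
  then show ?thesis unfolding Max floor by linarith
qed

end
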